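(* For every unit $i_0\in I$, the set of output volumes attainable by $i_0$, i.e. the set of all values $\bar g_{i_0}$ occurring in elements $\bar x\in\overline{\Omega}$, is the closed interval $[\bar g_{i_0}^{\min},\bar g_{i_0}^{\max}]$ with $$\bar g_{i_0}^{\min}=\max\Big(d-\sum_{i\in I,\,i\ne i_0}g_i^{\max};\,0\Big),\qquad \bar g_{i_0}^{\max}=\min\big(d;\,g_{i_0}^{\max}\big).$$
   Context: Market data: $I=\{1,\dots,|I|\}$ is a finite nonempty set of generating units; for each $i\in I$: $g_i^{\max}>0$, $w_i\ge 0$, and $c_i:[0,g_i^{\max}]\to\mathbb{R}$ is a non-decreasing convex continuous function with $c_i(0)=0$. The demand $d$ is a fixed real number with $0\le d\le\sum_{i\in I}g_i^{\max}$. For $x_i=(u_i,g_i)$ the cost is $C_i(x_i)=c_i(g_i)+w_iu_i$, and the private feasible set is $X_i=\{(u_i,g_i): u_i\in\{0,1\},\ g_i\in\mathbb{R},\ 0\le g_i\le u_ig_i^{\max}\}$. The feasible set of the primal problem is $\Omega=\{x=(x_i)_{i\in I}: x_i=(u_i,g_i)\in X_i\ \forall i\in I,\ \sum_{i\in I}g_i=d\}$. Attainable schedules: $\overline{\Omega}$ is the set of all $\bar x=(\bar x_i)_{i\in I}$, $\bar x_i=(\bar u_i,\bar g_i)$ with $\bar u_i\in\{0,1\}$ and $0\le\bar g_i\le g_i^{\max}$, such that $\bar x$ is a minimizer of $\sum_{i\in I}C_i(x_i)$ over the set of all $x\in\Omega$ satisfying $u_i\le\bar u_i$ and $g_i\le\bar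 g_i$ for all $i\in I$ (in particular $\bar x$ itself belongs to $\Omega$). *)

theory Defs
  imports "HOL-Analysis.Analysis"
begin

text \<open>
  A schedule assigns to each unit \<open>i \<in> I\<close> the pair \<open>x i = (u\<^sub>i, g\<^sub>i)\<close> of commitment status and
  output. Schedules are families indexed by \<open>I\<close>, i.e. elements of a dependent product \<open>Pi\<^sub>E I\<close>.
\<close>

type_synonym 'i schedule = "'i \<Rightarrow> real \<times> real"

definition unit_cost :: "('i \<Rightarrow> real \<Rightarrow> real) \<Rightarrow> ('i \<Rightarrow> real) \<Rightarrow> 'i \<Rightarrow> real \<times> real \<Rightarrow> real" where
  "unit_cost c w i = (\<lambda>(u, g). c i g + w i * u)"

definition total_cost ::
    "'i set \<Rightarrow> ('i \<Rightarrow> real \<Rightarrow> real) \<Rightarrow> ('i \<Rightarrow> real) \<Rightarrow> 'i schedule \<Rightarrow> real" where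
  "total_cost I c w x = (\<Sum>i\<in>I. unit_cost c w i (x i))"

definition private_feasible :: "('i \<Rightarrow> real) \<Rightarrow> 'i \<Rightarrow> (real \<times> real) set" where
  "private_feasible gmax i = {(u, g). u \<in> {0, 1} \<and> 0 \<le> g \<and> g \<le> u * gmax i}"

definition feasible :: "'i set \<Rightarrow> ('i \<Rightarrow> real) \<Rightarrow> real \<Rightarrow> 'i schedule set" where
  "feasible I gmax d =
    {x \<in> Pi\<^sub>E I (private_feasible gmax). (\<Sum>i\<in>I. snd (x i)) = d}"

definition feasible_below ::
    "'i set \<Rightarrow> ('i \<Rightarrow> real) \<Rightarrow> real \<Rightarrow> 'i schedule \<Rightarrow> 'i schedule set" where
  "feasible_below I gmax d xbar =
    {x \<in> feasible I gmax d. \<forall>i\<in>I. fst (x i) \<le> fst (xbar i) \<and> snd (x i) \<le> snd (xbar i)}"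

definition attainable ::
    "'i set \<Rightarrow> ('i \<Rightarrow> real) \<Rightarrow> ('i \<Rightarrow> real \<Rightarrow> real) \<Rightarrow> ('i \<Rightarrow> real) \<Rightarrow> real \<Rightarrow> 'i schedule set" where
  "attainable I gmax c w d =
    {xbar \<in> (\<Pi>\<^sub>E i\<in>I. {0, 1} \<times> {0..gmax i}).
      is_arg_min (total_cost I c w) (\<lambda>x. x \<in> feasible_below I gmax d xbar) xbar}"

end

theory Submission
  imports Defs
begin

text \<open>
  The demand constraint is an equality, so a feasible schedule that lies below another feasible
  schedule \<open>xbar\<close> has the same outputs: outputs that are pointwise dominated and have the same sum
  coincide. Only commitments without output can still be lowered. Hence, if \<open>xbar\<close> commits exactly
  the units that produce, it is the only feasible schedule below itself and is trivially optimal
  there (\<open>tight_schedule_attainable\<close>). Every dispatch that satisfies the demand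
  and the capacities is therefore attainable, and the claim reduces to asking which outputs of
  \<open>i0\<close> can be completed to such a dispatch. The stated bounds are clearly necessary; they are
  sufficient because the residual demand can be shared among the other units in proportion to
  their capacities (\<open>proportional_dispatch\<close>).
\<close>

definition tight_schedule :: "'i set \<Rightarrow> ('i \<Rightarrow> real) \<Rightarrow> 'i schedule" where
  "tight_schedule I g = (\<lambda>i\<in>I. (if g i = 0 then 0 else 1, g i))"

lemma sum_eq_le_imp_eq:
  fixes f g :: "'i \<Rightarrow> real"
  assumes "finite I" and "\<And>i. i \<in> I \<Longrightarrow> f i \<le> g i" and "sum f I = sum g I" and "i \<in> I"
  shows "f i = g i"
proof -
  have "(\<Sum>i\<in>I. g i - f i) = 0"
    using assms(3) by (simp add: sum_subtractf)
  then have "\<forall>i\<in>I. g i - f i = 0"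
    using assms(1,2) by (subst (asm) sum_nonneg_eq_0_iff) auto
  with assms(4) show ?thesis by simp
qed

text \<open>Optimality holds because the schedule is its own only competitor.\<close>

lemma tight_schedule_attainable:
  fixes g :: "'i \<Rightarrow> real"
  assumes "finite I" and g: "\<And>i. i \<in> I \<Longrightarrow> 0 \<le> g i \<and> g i \<le> gmax i" and "sum g I = d"
  shows "tight_schedule I g \<in> attainable I gmax c w d"
proof -
  let ?x = "tight_schedule I g"
  have feas: "?x \<in> feasible I gmax d"
    using assms by (auto simp: tight_schedule_def feasible_def private_feasible_def)
  have unique: "y = ?x" if y: "y \<in> feasible_below I gmax d ?x" for y
  proof (rule extensionalityI[where A = I])
    show "y \<in> extensional I" "?x \<in> extensional I"
      using y by (auto simp: feasible_below_def feasible_def tight_schedule_def PiE_def)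
  next
    fix i assume i: "i \<in> I"
    have below: "\<And>j. j \<in> I \<Longrightarrow> fst (y j) \<le> fst (?x j) \<and> snd (y j) \<le> g j"
      and sum: "(\<Sum>j\<in>I. snd (y j)) = sum g I"
      and priv: "y i \<in> private_feasible gmax i"
      using y i assms(3) by (auto simp: feasible_below_def feasible_def tight_schedule_def)
    have out: "snd (y i) = g i"
      using sum_eq_le_imp_eq[of I "\<lambda>j. snd (y j)" g i] assms(1) below sum i by blast
    \<comment> \<open>An idle unit cannot be committed because \<open>y\<close> lies below, and a producing one must be.\<close>
    have "fst (y i) = (if g i = 0 then 0 else 1)"
      using priv out below[OF i] i g[OF i]
      by (cases "y i") (auto simp: private_feasible_def tight_schedule_def split: if_splits)
    with out i show "y i = ?x i"
      by (simp add: tight_schedule_def prod_eq_iff)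
  qed
  have "?x \<in> (\<Pi>\<^sub>E i\<in>I. {0, 1} \<times> {0..gmax i})"
    using g by (auto simp: tight_schedule_def)
  moreover have "?x \<in> feasible_below I gmax d ?x"
    using feas by (simp add: feasible_below_def)
  ultimately show ?thesis
    using unique by (auto simp: attainable_def is_arg_min_def)
qed

lemma proportional_dispatch:
  fixes m :: "'i \<Rightarrow> real"
  assumes "\<And>i. i \<in> J \<Longrightarrow> 0 \<le> m i" and "0 \<le> r" and "r \<le> sum m J"
  obtains h where "\<And>i. i \<in> J \<Longrightarrow> 0 \<le> h i \<and> h i \<le> m i" and "sum h J = r"
proof
  \<comment> \<open>If the total capacity is \<open>0\<close>, then \<open>r = 0\<close>, and \<open>r / 0 = 0\<close> is the right factor.\<close>
  let ?t = "r / sum m J"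
  have t: "0 \<le> ?t" "?t \<le> 1"
    using assms by (auto simp: divide_le_eq_1)
  show "0 \<le> ?t * m i \<and> ?t * m i \<le> m i" if "i \<in> J" for i
    using t assms(1)[OF that] mult_left_le_one_le[of "m i" ?t]
      mult_nonneg_nonneg[of ?t "m i"] by blast
  show "(\<Sum>i\<in>J. ?t * m i) = r"
    using assms(2,3) by (cases "sum m J = 0") (simp_all flip: sum_distrib_left sum_divide_distrib)
qed

lemma attainable_output_bounds:
  assumes "finite I" and "i0 \<in> I" and x: "x \<in> attainable I gmax c w d"
  shows "snd (x i0) \<in> {max (d - (\<Sum>i\<in>I - {i0}. gmax i)) 0 .. min d (gmax i0)}"
proof -
  have cap: "\<And>i. i \<in> I \<Longrightarrow> 0 \<le> snd (x i) \<and> snd (x i) \<le> gmax i"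
    using x by (fastforce simp: attainable_def PiE_iff mem_Times_iff)
  have "(\<Sum>i\<in>I. snd (x i)) = d"
    using x by (auto simp: attainable_def is_arg_min_def feasible_below_def feasible_def)
  then have split: "d = snd (x i0) + (\<Sum>i\<in>I - {i0}. snd (x i))"
    using assms(1,2) by (simp add: sum.remove)
  have "0 \<le> (\<Sum>i\<in>I - {i0}. snd (x i))"
    using cap by (intro sum_nonneg) auto
  moreover have "(\<Sum>i\<in>I - {i0}. snd (x i)) \<le> (\<Sum>i\<in>I - {i0}. gmax i)"
    using cap by (intro sum_mono) auto
  ultimately show ?thesis
    using split cap[OF assms(2)] by auto
qed

theorem mainTheorem3:
  fixes I :: "'i set"
    and gmax w :: "'i \<Rightarrow> real"
    and c :: "'i \<Rightarrow> real \<Rightarrow> real"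
    and d :: real
    and i0 :: 'i
  assumes "finite I" and "I \<noteq> {}"
    and "\<And>i. i \<in> I \<Longrightarrow> gmax i > 0"
    and "\<And>i. i \<in> I \<Longrightarrow> w i \<ge> 0"
    and "\<And>i. i \<in> I \<Longrightarrow> mono_on {0..gmax i} (c i)"
    and "\<And>i. i \<in> I \<Longrightarrow> convex_on {0..gmax i} (c i)"
    and "\<And>i. i \<in> I \<Longrightarrow> continuous_on {0..gmax i} (c i)"
    and "\<And>i. i \<in> I \<Longrightarrow> c i 0 = 0"
    and "0 \<le> d" and "d \<le> (\<Sum>i\<in>I. gmax i)"
    and "i0 \<in> I"
  shows "{snd (xbar i0) | xbar. xbar \<in> attainable I gmax c w d} =
           {max (d - (\<Sum>i\<in>I - {i0}. gmax i)) 0 .. min d (gmax i0)}"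
proof
  show "{snd (xbar i0) | xbar. xbar \<in> attainable I gmax c w d}
          \<subseteq> {max (d - (\<Sum>i\<in>I - {i0}. gmax i)) 0 .. min d (gmax i0)}"
    using attainable_output_bounds[OF assms(1,11)] by blast
next
  show "{max (d - (\<Sum>i\<in>I - {i0}. gmax i)) 0 .. min d (gmax i0)}
          \<subseteq> {snd (xbar i0) | xbar. xbar \<in> attainable I gmax c w d}"
  proof
    fix a assume a: "a \<in> {max (d - (\<Sum>i\<in>I - {i0}. gmax i)) 0 .. min d (gmax i0)}"
    obtain h where h: "\<And>i. i \<in> I - {i0} \<Longrightarrow> 0 \<le> h i \<and> h i \<le> gmax i"
      and sum_h: "sum h (I - {i0}) = d - a"
    proof (rule proportional_dispatch[of "I - {i0}" gmax "d - a"])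
      show "0 \<le> gmax i" if "i \<in> I - {i0}" for i
        using that assms(3)[of i] by simp
    qed (use a in auto)
    let ?g = "h(i0 := a)"
    have "sum ?g I = ?g i0 + sum ?g (I - {i0})"
      by (rule sum.remove[OF assms(1,11)])
    also have "sum ?g (I - {i0}) = sum h (I - {i0})"
      by (intro sum.cong) auto
    finally have "sum ?g I = d"
      using sum_h by simp
    moreover have "0 \<le> ?g i \<and> ?g i \<le> gmax i" if "i \<in> I" for i
      using that h[of i] a by auto
    ultimately have "tight_schedule I ?g \<in> attainable I gmax c w d"
      using tight_schedule_attainable[OF assms(1)] by blast
    moreover have "snd (tight_schedule I ?g i0) = a"
      using assms(11) by (simp add: tight_schedule_def)
    ultimately show "a \<in> {snd (xbar i0) | xbar. xbar \<in> attainable I gmax c w d}"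
      by (intro CollectI exI[of _ "tight_schedule I ?g"]) simp
  qed
qed

end
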